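(* Let $\alpha\in(0,1)$, $s\in[0,1)$, $c_0\in(0,1)$, and let $(L_i,W_i,\mathbf{x}_i)_{i=1}^m$ be the (label, winning score, side information) triples of $m$ hypotheses $H_1,\dots,H_m$, with $L_i\in\{\pm1\}$ and with $N\subseteq[m]$ the set of indices of the true null hypotheses. Assume that, conditioned on $W=(W_i)_{i=1}^m$, the side information $\mathbf{x}=(\mathbf{x}_i)_{i=1}^m$, and the labels $(L_i)_{i\notin N}$ of the false null hypotheses, the true null labels $(L_i)_{i\in N}$ are independent $\pm1$ random variables, each of which satisfies $\mathbb{P}(L_i=1)\le c_0$ (conditional probability). Then the RESET procedure in its FDR mode (defined in the context), run with threshold $\alpha$, training probability $s$, bound $c_0$ and any rescoring model $f$, controls the FDR at level $\alpha$: its discovery list $R_\alpha$ satisfies $$\mathbb{E}\left[\frac{|R_\alpha\cap N|}{|R_\alpha|\vee 1}\right]\le\alpha .$$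
   Context: Notation: $[m]=\{1,\dots,m\}$, $a\vee b=\max\{a,b\}$. A hypothesis with $L_i=1$ is called a target win, one with $L_i=-1$ a decoy win. The set $N$ is non-random. The false discovery proportion (FDP) of a discovery list $R\subseteq[m]$ is $|R\cap N|/(|R|\vee1)$, and the FDR is its expectation. RESET, FDR mode, with input $(L_i,W_i,\mathbf{x}_i)_{i=1}^m$, $\alpha$, $s$, $c_0$, $f$: 1. Each index $i$ with $L_i=-1$ is independently (and independently of everything else) declared a training decoy with probability $s$. The pseudo labels are $\tilde L_i=-1$ if $i$ is a training decoy and $\tilde L_i=1$ otherwise. In particular $\tilde L_i=1$ whenever $L_i=1$. Let $J=\{i\in[m]:\tilde L_i=1\}$. 2. New real-valued scores are computed as $(\widetilde W_i)_{i=1}^m=f\big((W_i,\mathbf{x}_i,\tilde L_i)_{i=1}^m\big)$, where $f$ is an arbitrary (measurable) rescoring map. It may use auxiliary randomness independent of everything else, but it has no access to the labels $L_i$ other than through $\tilde L$. 3. The training decoys are discarded, and Selective SeqStep+ is applied to $(L_i,\widetilde W_i)_{i\in J}$ at level $\alpha$ with parameter $$c=c_e:=\frac{c_0}{1-s(1-c_0)}\in(0,1).$$ Selective SeqStep+ with parameters $c,\alpha$: sort the pairs in decreasing order of score (ties broken at random). For each $t$ let $A_t$ be the number of labels equal to $-1$ and $R_t$ the number of labels equal to $+1$ among the top $t$ scores. Set $$\tau=\max\left\{t:\ \frac{A_t+1}{R_t\vee1}\cdot\frac{c}{1-c}\le\alpha\right\}.$$ The discovery list consists of the indices $i$ that are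 ranked in the top $\tau$ and have $L_i=1$. It is empty if no such $t$ exists. *)

theory Defs
  imports "HOL-Probability.Probability" "HOL-Combinatorics.Multiset_Permutations"
begin

text \<open>Conditioning is with respect to a sub-sigma-algebra \<open>F\<close> of \<open>M\<close>.\<close>

definition sigma_cond_prob :: "'a measure \<Rightarrow> 'a measure \<Rightarrow> 'a set \<Rightarrow> 'a \<Rightarrow> real" where
  "sigma_cond_prob M F A = real_cond_exp M F (indicator A)"

definition cond_indep_vars ::
  "'a measure \<Rightarrow> 'a measure \<Rightarrow> ('i \<Rightarrow> 'b measure) \<Rightarrow> ('i \<Rightarrow> 'a \<Rightarrow> 'b) \<Rightarrow> 'i set \<Rightarrow> bool" where
  "cond_indep_vars M F M' Y I \<longleftrightarrow>
     (\<forall>i\<in>I. Y i \<in> measurable M (M' i)) \<and>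
     (\<forall>K\<subseteq>I. K \<noteq> {} \<longrightarrow> finite K \<longrightarrow> (\<forall>A\<in>(\<Pi> i\<in>K. sets (M' i)).
        AE \<omega> in M. sigma_cond_prob M F (\<Inter>i\<in>K. Y i -` A i \<inter> space M) \<omega>
                 = (\<Prod>i\<in>K. sigma_cond_prob M F (Y i -` A i \<inter> space M) \<omega>)))"

text \<open>The sigma-algebra generated by all scores, all side information, and the labels of the false
  nulls.\<close>

definition conditioning_algebra ::
  "'a measure \<Rightarrow> 'x measure \<Rightarrow> nat \<Rightarrow> nat set \<Rightarrow> (nat \<Rightarrow> 'a \<Rightarrow> int) \<Rightarrow> (nat \<Rightarrow> 'a \<Rightarrow> real) \<Rightarrow>
   (nat \<Rightarrow> 'a \<Rightarrow> 'x) \<Rightarrow> 'a measure" where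
  "conditioning_algebra M X m N L W x =
     vimage_algebra (space M)
       (\<lambda>\<omega>. (\<lambda>i\<in>{1..m}. W i \<omega>, \<lambda>i\<in>{1..m}. x i \<omega>, \<lambda>i\<in>{1..m} - N. L i \<omega>))
       ((\<Pi>\<^sub>M i\<in>{1..m}. borel) \<Otimes>\<^sub>M (\<Pi>\<^sub>M i\<in>{1..m}. X) \<Otimes>\<^sub>M (\<Pi>\<^sub>M i\<in>{1..m} - N. count_space UNIV))"

text \<open>Selective SeqStep+. The argument \<open>enum\<close> lists the competing indices; since \<^const>\<open>sort_key\<close> is
  stable, indices with equal scores are ranked in the order in which they occur in \<open>enum\<close>.\<close>

definition seqstep_ranking :: "(nat \<Rightarrow> real) \<Rightarrow> nat list \<Rightarrow> nat list" where
  "seqstep_ranking w enum = sort_key (\<lambda>i. - w i) enum"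

definition label_count :: "(nat \<Rightarrow> int) \<Rightarrow> int \<Rightarrow> nat list \<Rightarrow> nat" where
  "label_count l v js = length (filter (\<lambda>i. l i = v) js)"

definition seqstep_cutoffs :: "real \<Rightarrow> real \<Rightarrow> (nat \<Rightarrow> int) \<Rightarrow> nat list \<Rightarrow> nat set" where
  "seqstep_cutoffs c \<alpha> l ranking =
     {t \<in> {1..length ranking}.
        (real (label_count l (-1) (take t ranking)) + 1)
          / real (max (label_count l 1 (take t ranking)) 1) * (c / (1 - c)) \<le> \<alpha>}"

definition selective_seqstep_plus ::
  "real \<Rightarrow> real \<Rightarrow> (nat \<Rightarrow> int) \<Rightarrow> (nat \<Rightarrow> real) \<Rightarrow> nat list \<Rightarrow> nat set" where
  "selective_seqstep_plus c \<alpha> l w enum =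
     (let ranking = seqstep_ranking w enum; T = seqstep_cutoffs c \<alpha> l ranking in
      if T = {} then {} else {i \<in> set (take (Max T) ranking). l i = 1})"

text \<open>RESET as a deterministic function of the observed data \<open>l, w, x\<close> and of its internal
  randomness: the coins \<open>b\<close> (one per index, but used only where \<open>l i = -1\<close>), the seed \<open>u\<close> of the
  rescoring map \<open>f\<close>, and an enumeration \<open>enum\<close> of the indices which breaks ties.\<close>

definition pseudo_label :: "(nat \<Rightarrow> int) \<Rightarrow> (nat \<Rightarrow> bool) \<Rightarrow> nat \<Rightarrow> int" where
  "pseudo_label l b i = (if l i = -1 \<and> b i then -1 else 1)"

definition reset_discoveries ::
  "nat \<Rightarrow> real \<Rightarrow> real \<Rightarrow> real \<Rightarrow> ('u \<Rightarrow> (nat \<Rightarrow> real \<times> 'x \<times> int) \<Rightarrow> nat \<Rightarrow> real) \<Rightarrow>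
   (nat \<Rightarrow> int) \<Rightarrow> (nat \<Rightarrow> real) \<Rightarrow> (nat \<Rightarrow> 'x) \<Rightarrow>
   (nat \<Rightarrow> bool) \<Rightarrow> 'u \<Rightarrow> nat list \<Rightarrow> nat set" where
  "reset_discoveries m \<alpha> s c0 f l w x b u enum =
     (let l' = pseudo_label l b;
          w' = f u (\<lambda>i\<in>{1..m}. (w i, x i, l' i));
          c = c0 / (1 - s * (1 - c0))
      in selective_seqstep_plus c \<alpha> l w' (filter (\<lambda>i. l' i = 1) enum))"

text \<open>The law of the internal randomness: independent Bernoulli coins, the seed of the rescoring
  map, and a uniformly random enumeration of the indices, all independent. The space of the last
  factor consists of the enumerations of \<open>{1..m}\<close> only, so that data with indices outside \<open>{1..m}\<close>
  plays no role, not even for measurability.\<close>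

definition reset_randomness ::
  "nat \<Rightarrow> real \<Rightarrow> 'u measure \<Rightarrow> ((nat \<Rightarrow> bool) \<times> 'u \<times> nat list) measure" where
  "reset_randomness m s U =
     (\<Pi>\<^sub>M i\<in>{1..m}. measure_pmf (bernoulli_pmf s)) \<Otimes>\<^sub>M U \<Otimes>\<^sub>M
     uniform_count_measure (permutations_of_set {1..m})"

definition fdp :: "nat set \<Rightarrow> nat set \<Rightarrow> real" where
  "fdp N R = real (card (R \<inter> N)) / real (max (card R) 1)"

text \<open>The product measure makes the internal randomness independent of the data.\<close>

definition reset_fdr ::
  "'a measure \<Rightarrow> 'u measure \<Rightarrow> nat \<Rightarrow> nat set \<Rightarrow> real \<Rightarrow> real \<Rightarrow> real \<Rightarrow>
   ('u \<Rightarrow> (nat \<Rightarrow> real \<times> 'x \<times> int) \<Rightarrow> nat \<Rightarrow> real) \<Rightarrow>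
   (nat \<Rightarrow> 'a \<Rightarrow> int) \<Rightarrow> (nat \<Rightarrow> 'a \<Rightarrow> real) \<Rightarrow> (nat \<Rightarrow> 'a \<Rightarrow> 'x) \<Rightarrow> real" where
  "reset_fdr M U m N \<alpha> s c0 f L W x =
     (\<integral>(\<omega>, b, u, enum).
        fdp N (reset_discoveries m \<alpha> s c0 f (\<lambda>i. L i \<omega>) (\<lambda>i. W i \<omega>) (\<lambda>i. x i \<omega>) b u enum)
      \<partial>(M \<Otimes>\<^sub>M reset_randomness m s U))"

end

theory Submission imports Defs begin

text \<open>Leave-one-out instead of a martingale. For an index \<open>j\<close>, run the procedure with the label of
  \<open>j\<close> replaced by \<open>1\<close>, and let the weight of \<open>j\<close> be \<open>1 / (1 + A)\<close> if \<open>j\<close> lies above the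
  resulting cutoff, where \<open>A\<close> counts the decoys above it, and \<open>0\<close> otherwise. By the definition of
  the cutoff, the FDP is at most \<open>\<alpha> (1 - c) / c\<close> times the sum of the weights of the null target
  wins. The weight of \<open>j\<close> depends neither on the label nor on the coin of \<open>j\<close>, so conditional
  independence lets us trade the event \<open>L j = 1\<close> for the event that \<open>j\<close> is a decoy but not a
  training decoy, at the price of the factor \<open>c0 / ((1 - c0) (1 - s)) = c / (1 - c)\<close>. Finally, the
  weights of the competing decoys sum to at most \<open>1\<close>.\<close>

section \<open>Leave-one-out weights\<close>

lemma label_count_eq_card:
  assumes "distinct js"
  shows "label_count l v js = card {i \<in> set js. l i = v}"
  using assms unfolding label_count_def by (simp add: distinct_length_filter Int_def conj_commute)

text \<open>The flip moves exactly one unit from the decoy count to the target count, whichever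
  decoy of the prefix is chosen. Hence flips of two different decoys of the same prefix pass or fail
  the cutoff test together.\<close>

lemma label_count_flip:
  assumes "distinct js" "j \<in> set js" "l j = -1"
  shows "label_count l (-1) js = Suc (label_count (l(j := 1)) (-1) js)"
    and "label_count (l(j := 1)) 1 js = Suc (label_count l 1 js)"
proof -
  have "{i \<in> set js. l i = -1} = insert j {i \<in> set js. (l(j := 1)) i = -1}"
    and "{i \<in> set js. (l(j := 1)) i = 1} = insert j {i \<in> set js. l i = 1}"
    using assms by auto
  then show "label_count l (-1) js = Suc (label_count (l(j := 1)) (-1) js)"
    and "label_count (l(j := 1)) 1 js = Suc (label_count l 1 js)"
    using assms by (simp_all add: label_count_eq_card)
qed

text \<open>The denominator is the numerator \<open>A + 1\<close> of the cutoff test, taken at the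
  last admissible cutoff. The label of \<open>j\<close> is not inspected here: the flip to
  \<open>1\<close> is made in the argument \<open>l\<close>.\<close>

definition seqstep_weight :: "real \<Rightarrow> real \<Rightarrow> (nat \<Rightarrow> int) \<Rightarrow> nat list \<Rightarrow> nat \<Rightarrow> real" where
  "seqstep_weight c \<alpha> l r j =
     (let T = seqstep_cutoffs c \<alpha> l r in
      if T = {} \<or> j \<notin> set (take (Max T) r) then 0
      else 1 / (1 + real (label_count l (-1) (take (Max T) r))))"

lemma seqstep_weight_nonneg: "0 \<le> seqstep_weight c \<alpha> l r j"
  by (simp add: seqstep_weight_def Let_def)

lemma seqstep_weight_le_1: "seqstep_weight c \<alpha> l r j \<le> 1"
  by (simp add: seqstep_weight_def Let_def)

lemma finite_seqstep_cutoffs: "finite (seqstep_cutoffs c \<alpha> l r)"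
  by (simp add: seqstep_cutoffs_def)

text \<open>Every null discovery contributes \<open>1 / k\<close> to the FDP, where \<open>k\<close>
  is the number of discoveries or \<open>1\<close>. Solved for \<open>1 / k\<close>, the cutoff
  inequality bounds this by \<open>\<alpha> * ((1 - c) / c)\<close> times the weight of that
  discovery.\<close>

lemma fdp_le_sum_seqstep_weight:
  assumes "distinct r" "finite N" "0 < c" "c < 1"
  shows "fdp N (let T = seqstep_cutoffs c \<alpha> l r in
                if T = {} then {} else {i \<in> set (take (Max T) r). l i = 1})
       \<le> \<alpha> * ((1 - c) / c) * (\<Sum>j\<in>N. if l j = 1 then seqstep_weight c \<alpha> l r j else 0)"
proof (cases "seqstep_cutoffs c \<alpha> l r = {}")
  case True
  then have "seqstep_weight c \<alpha> l r j = 0" for j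
    by (simp add: seqstep_weight_def)
  with True show ?thesis by (simp add: fdp_def cong: if_cong)
next
  case False
  define t where "t = Max (seqstep_cutoffs c \<alpha> l r)"
  define R where "R = {i \<in> set (take t r). l i = 1}"
  define a where "a = real (label_count l (-1) (take t r)) + 1"
  define k where "k = real (max (card R) 1)"
  have card_R: "card R = label_count l 1 (take t r)"
    using assms(1) by (simp add: R_def label_count_eq_card)
  have "t \<in> seqstep_cutoffs c \<alpha> l r"
    unfolding t_def using False finite_seqstep_cutoffs by (rule Max_in[rotated])
  then have "a / k * (c / (1 - c)) \<le> \<alpha>"
    unfolding seqstep_cutoffs_def a_def k_def card_R by simp
  moreover have "a > 0" "k > 0" by (auto simp: a_def k_def)
  ultimately have "1 / k \<le> \<alpha> * ((1 - c) / c) / a"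
    using assms(3,4) by (simp add: field_simps)
  then have "real (card (R \<inter> N)) * (1 / k) \<le> real (card (R \<inter> N)) * (\<alpha> * ((1 - c) / c) / a)"
    by (intro mult_left_mono) auto
  also have "\<dots> = \<alpha> * ((1 - c) / c) * (\<Sum>j\<in>R \<inter> N. 1 / a)"
    by simp
  also have "(\<Sum>j\<in>R \<inter> N. 1 / a) = (\<Sum>j\<in>N. if j \<in> R then 1 / a else 0)"
    using assms(2) by (simp add: sum.If_cases Int_commute)
  also have "\<dots> = (\<Sum>j\<in>N. if l j = 1 then seqstep_weight c \<alpha> l r j else 0)"
    using False by (intro sum.cong) (auto simp: R_def seqstep_weight_def Let_def t_def a_def)
  finally show ?thesis
    using False by (simp add: fdp_def Let_def t_def R_def k_def)
qed

text \<open>Two decoys that survive their own flip to a target have the same cutoff after that flip: the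
  larger of the two cutoffs lies beyond both of them, where the two flips give equal counts.\<close>

lemma sum_seqstep_weight_flip_le_1:
  assumes "distinct r" "finite N"
  shows "(\<Sum>j\<in>N. if l j = -1 then seqstep_weight c \<alpha> (l(j := 1)) r j else 0) \<le> 1"
proof -
  define T where "T j = seqstep_cutoffs c \<alpha> (l(j := 1)) r" for j
  define S where "S = {j \<in> N. l j = -1 \<and> T j \<noteq> {} \<and> j \<in> set (take (Max (T j)) r)}"
  have Max_le: "Max (T j) \<le> Max (T k)" if "j \<in> S" "k \<in> S" for j k
  proof (rule ccontr)
    assume less: "\<not> Max (T j) \<le> Max (T k)"
    let ?t = "Max (T j)"
    have in_T: "?t \<in> T j"
      using that finite_seqstep_cutoffs unfolding S_def T_def by (intro Max_in) auto
    have "k \<in> set (take ?t r)"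
      using that less set_take_subset_set_take[of "Max (T k)" ?t r] by (auto simp: S_def)
    moreover have "j \<in> set (take ?t r)" "l j = -1" "l k = -1"
      using that by (auto simp: S_def)
    ultimately have "label_count (l(j := 1)) v (take ?t r) = label_count (l(k := 1)) v (take ?t r)"
      if "v \<in> {-1, 1}" for v
      using that assms(1) label_count_flip[of "take ?t r" j l] label_count_flip[of "take ?t r" k l]
      by auto
    then have "?t \<in> T k"
      using in_T by (simp add: T_def seqstep_cutoffs_def)
    then have "?t \<le> Max (T k)"
      by (simp add: T_def finite_seqstep_cutoffs)
    with less show False ..
  qed
  have sum_eq: "(\<Sum>j\<in>N. if l j = -1 then seqstep_weight c \<alpha> (l(j := 1)) r j else 0)
      = (\<Sum>j\<in>S. seqstep_weight c \<alpha> (l(j := 1)) r j)"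
    using assms(2)
    by (intro sum.mono_neutral_cong_right) (auto simp: S_def T_def seqstep_weight_def Let_def)
  show ?thesis
  proof (cases "S = {}")
    case True
    then show ?thesis by (simp add: sum_eq)
  next
    case False
    then obtain k where k: "k \<in> S" by blast
    define js where "js = take (Max (T k)) r"
    have js: "distinct js" using assms(1) by (simp add: js_def)
    have Max_eq: "Max (T j) = Max (T k)" if "j \<in> S" for j
      using Max_le that k by (simp add: antisym)
    have S_sub: "S \<subseteq> {i \<in> set js. l i = -1}"
    proof
      fix j assume j: "j \<in> S"
      then have "l j = -1" "j \<in> set (take (Max (T j)) r)" by (auto simp: S_def)
      with Max_eq[OF j] show "j \<in> {i \<in> set js. l i = -1}" by (simp add: js_def)
    qed
    \<comment> \<open>The flip removes one decoy from the common prefix and the \<open>1 +\<close>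
      in the weight restores it, so all members of \<open>S\<close> have the same weight.\<close>
    have "seqstep_weight c \<alpha> (l(j := 1)) r j = 1 / real (label_count l (-1) js)" if "j \<in> S" for j
    proof -
      have "label_count l (-1) js = Suc (label_count (l(j := 1)) (-1) js)"
        using that S_sub js by (intro label_count_flip) auto
      moreover have "T j \<noteq> {}" "j \<in> set (take (Max (T j)) r)"
        using that by (auto simp: S_def)
      then have "seqstep_weight c \<alpha> (l(j := 1)) r j = 1 / (1 + real (label_count (l(j := 1)) (-1) js))"
        unfolding seqstep_weight_def Let_def T_def[symmetric] js_def Max_eq[OF that] by simp
      ultimately show ?thesis by simp
    qed
    then have "(\<Sum>j\<in>S. seqstep_weight c \<alpha> (l(j := 1)) r j) = real (card S) / real (label_count l (-1) js)"
      by simp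
    \<comment> \<open>All members of \<open>S\<close> are among the decoys counted in the
      denominator.\<close>
    also have "\<dots> \<le> 1"
      using card_mono[OF _ S_sub] by (simp add: label_count_eq_card[OF js] divide_le_eq_1 card_gt_0_iff) blast
    finally show ?thesis by (simp add: sum_eq)
  qed
qed

section \<open>Rankings depend on the scores only through their order, so scores may be replaced by
  ranks\<close>

lemma sort_key_cong_order:
  assumes "\<And>i k. i \<in> set xs \<Longrightarrow> k \<in> set xs \<Longrightarrow> f i \<le> f k \<longleftrightarrow> g i \<le> g k"
  shows "sort_key f xs = sort_key g xs"
  using assms
proof (induction xs)
  case (Cons a xs)
  note order = Cons.prems
  have insort: "insort_key f a ys = insort_key g a ys" if "set ys \<subseteq> set xs" for ys
    using that
  proof (induction ys)
    case (Cons y ys)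
    then have "f a \<le> f y \<longleftrightarrow> g a \<le> g y"
      by (intro order[of a y]) auto
    with Cons show ?case by simp
  qed simp
  have "sort_key f xs = sort_key g xs"
    by (rule Cons.IH, rule order) auto
  then show ?case
    using insort[of "sort_key g xs"] by simp
qed simp

text \<open>The relation \<open>R\<close> takes only finitely many values, so that everything computed from a ranking
  is measurable as soon as \<open>R\<close> is.\<close>

lemma seqstep_ranking_ranks:
  assumes "finite I" "set e \<subseteq> I" "R = {p \<in> I \<times> I. w (fst p) \<le> w (snd p)}"
  shows "seqstep_ranking w e = seqstep_ranking (\<lambda>i. real (card {k. (k, i) \<in> R})) e"
  unfolding seqstep_ranking_def
proof (rule sort_key_cong_order)
  fix i k assume "i \<in> set e" "k \<in> set e"
  then have I: "i \<in> I" "k \<in> I" using assms(2) by auto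
  have R: "{h. (h, i) \<in> R} = {h \<in> I. w h \<le> w i}" "{h. (h, k) \<in> R} = {h \<in> I. w h \<le> w k}"
    using I assms(3) by auto
  have "card {h. (h, k) \<in> R} \<le> card {h. (h, i) \<in> R} \<longleftrightarrow> w k \<le> w i"
  proof
    assume "w k \<le> w i"
    then show "card {h. (h, k) \<in> R} \<le> card {h. (h, i) \<in> R}"
      unfolding R using assms(1) by (intro card_mono) auto
  next
    assume *: "card {h. (h, k) \<in> R} \<le> card {h. (h, i) \<in> R}"
    show "w k \<le> w i"
    proof (rule ccontr)
      assume "\<not> w k \<le> w i"
      \<comment> \<open>The index \<open>k\<close> itself witnesses that the inclusion is
        strict.\<close>
      then have "{h. (h, i) \<in> R} \<subset> {h. (h, k) \<in> R}"
        unfolding R using I by force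
      then have "card {h. (h, i) \<in> R} < card {h. (h, k) \<in> R}"
        using assms(1) by (intro psubset_card_mono) (simp_all add: R)
      with * show False by simp
    qed
  qed
  then show "- w i \<le> - w k \<longleftrightarrow>
      - real (card {h. (h, i) \<in> R}) \<le> - real (card {h. (h, k) \<in> R})"
    by simp
qed

section \<open>Rankings and leave-one-out weights of the full procedure\<close>

definition reset_ranking ::
  "nat \<Rightarrow> ('u \<Rightarrow> (nat \<Rightarrow> real \<times> 'x \<times> int) \<Rightarrow> nat \<Rightarrow> real) \<Rightarrow>
   (nat \<Rightarrow> int) \<Rightarrow> (nat \<Rightarrow> real) \<Rightarrow> (nat \<Rightarrow> 'x) \<Rightarrow>
   (nat \<Rightarrow> bool) \<Rightarrow> 'u \<Rightarrow> nat list \<Rightarrow> nat list" where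
  "reset_ranking m f l w x b u e =
     seqstep_ranking (f u (\<lambda>i\<in>{1..m}. (w i, x i, pseudo_label l b i)))
       (filter (\<lambda>i. pseudo_label l b i = 1) e)"

lemma set_reset_ranking: "set (reset_ranking m f l w x b u e) \<subseteq> set e"
  by (auto simp: reset_ranking_def seqstep_ranking_def)

lemma distinct_reset_ranking: "distinct e \<Longrightarrow> distinct (reset_ranking m f l w x b u e)"
  by (simp add: reset_ranking_def seqstep_ranking_def)

text \<open>The labels enter only through the pseudo labels, and the coin of a target win is never
  read. This is why the coins have to agree at decoys only.\<close>

lemma reset_ranking_cong:
  assumes "\<And>i. i \<in> {1..m} \<Longrightarrow> l i = l' i" "\<And>i. i \<in> {1..m} \<Longrightarrow> w i = w' i"
    "\<And>i. i \<in> {1..m} \<Longrightarrow> x i = x' i" "\<And>i. i \<in> {1..m} \<Longrightarrow> l i = -1 \<Longrightarrow> b i = b' i"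
    "set e \<subseteq> {1..m}"
  shows "reset_ranking m f l w x b u e = reset_ranking m f l' w' x' b' u e"
proof -
  have *: "pseudo_label l b i = pseudo_label l' b' i" if "i \<in> {1..m}" for i
    using assms(1)[OF that] assms(4)[OF that] by (auto simp: pseudo_label_def)
  have "(\<lambda>i\<in>{1..m}. (w i, x i, pseudo_label l b i)) = (\<lambda>i\<in>{1..m}. (w' i, x' i, pseudo_label l' b' i))"
    using assms(2,3) * by (intro restrict_ext) simp
  moreover have "filter (\<lambda>i. pseudo_label l b i = 1) e = filter (\<lambda>i. pseudo_label l' b' i = 1) e"
    using assms(5) * by (intro filter_cong) auto
  ultimately show ?thesis
    by (simp add: reset_ranking_def)
qed

lemma reset_discoveries_eq:
  "reset_discoveries m \<alpha> s c0 f l w x b u e =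
     (let r = reset_ranking m f l w x b u e; T = seqstep_cutoffs (c0 / (1 - s * (1 - c0))) \<alpha> l r in
      if T = {} then {} else {i \<in> set (take (Max T) r). l i = 1})"
  by (simp add: reset_discoveries_def selective_seqstep_plus_def reset_ranking_def Let_def)

text \<open>The label of \<open>j\<close> is set to \<open>1\<close> in the ranking as well as in
  the counts. The pseudo label of \<open>j\<close> is then \<open>1\<close> whatever its coin shows,
  which removes the dependence on both the label and the coin of \<open>j\<close>.\<close>

definition reset_weight ::
  "nat \<Rightarrow> real \<Rightarrow> real \<Rightarrow> ('u \<Rightarrow> (nat \<Rightarrow> real \<times> 'x \<times> int) \<Rightarrow> nat \<Rightarrow> real) \<Rightarrow>
   (nat \<Rightarrow> int) \<Rightarrow> (nat \<Rightarrow> real) \<Rightarrow> (nat \<Rightarrow> 'x) \<Rightarrow>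
   (nat \<Rightarrow> bool) \<Rightarrow> 'u \<Rightarrow> nat list \<Rightarrow> nat \<Rightarrow> real" where
  "reset_weight m c \<alpha> f l w x b u e j =
     seqstep_weight c \<alpha> (l(j := 1)) (reset_ranking m f (l(j := 1)) w x b u e) j"

lemma reset_weight_nonneg: "0 \<le> reset_weight m c \<alpha> f l w x b u e j"
  and reset_weight_le_1: "reset_weight m c \<alpha> f l w x b u e j \<le> 1"
  by (simp_all add: reset_weight_def seqstep_weight_nonneg seqstep_weight_le_1)

lemma seqstep_weight_cong:
  assumes "\<And>i. i \<in> set r \<Longrightarrow> l i = l' i"
  shows "seqstep_weight c \<alpha> l r j = seqstep_weight c \<alpha> l' r j"
proof -
  have *: "label_count l v (take t r) = label_count l' v (take t r)" for v t
    unfolding label_count_def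
    by (intro arg_cong[where f = length] filter_cong refl) (metis assms in_set_takeD)
  then have "seqstep_cutoffs c \<alpha> l r = seqstep_cutoffs c \<alpha> l' r"
    by (simp add: seqstep_cutoffs_def)
  with * show ?thesis
    by (simp add: seqstep_weight_def Let_def)
qed

text \<open>This is the leave-one-out property: labels and coins may differ at \<open>j\<close>. It
  justifies both exchanges in the main proof, of the label of \<open>j\<close> and of its
  coin.\<close>

lemma reset_weight_cong:
  assumes "\<And>i. i \<in> {1..m} \<Longrightarrow> i \<noteq> j \<Longrightarrow> l i = l' i"
    "\<And>i. i \<in> {1..m} \<Longrightarrow> w i = w' i" "\<And>i. i \<in> {1..m} \<Longrightarrow> x i = x' i"
    "\<And>i. i \<in> {1..m} \<Longrightarrow> i \<noteq> j \<Longrightarrow> b i = b' i" "set e \<subseteq> {1..m}"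
  shows "reset_weight m c \<alpha> f l w x b u e j = reset_weight m c \<alpha> f l' w' x' b' u e j"
proof -
  have "reset_ranking m f (l(j := 1)) w x b u e = reset_ranking m f (l'(j := 1)) w' x' b' u e"
    using assms by (intro reset_ranking_cong) (auto split: if_splits)
  then show ?thesis
    unfolding reset_weight_def
    using set_reset_ranking[of m f "l'(j := 1)" w' x' b' u e] assms(1,5)
    by (simp, intro seqstep_weight_cong) auto
qed

text \<open>Where \<open>l j = 1\<close>, setting the label of \<open>j\<close> to \<open>1\<close>
  changes nothing, so the weight from the actual run and the leave-one-out weight coincide.\<close>

lemma fdp_reset_le:
  assumes "distinct e" "finite N" "0 < c" "c < 1" "c = c0 / (1 - s * (1 - c0))"
  shows "fdp N (reset_discoveries m \<alpha> s c0 f l w x b u e)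
       \<le> \<alpha> * ((1 - c) / c) * (\<Sum>j\<in>N. if l j = 1 then reset_weight m c \<alpha> f l w x b u e j else 0)"
proof -
  let ?r = "reset_ranking m f l w x b u e"
  have "fdp N (reset_discoveries m \<alpha> s c0 f l w x b u e)
      \<le> \<alpha> * ((1 - c) / c) * (\<Sum>j\<in>N. if l j = 1 then seqstep_weight c \<alpha> l ?r j else 0)"
    unfolding reset_discoveries_eq Let_def[of ?r] assms(5)[symmetric]
    using assms(1-4) by (intro fdp_le_sum_seqstep_weight distinct_reset_ranking)
  also have "(\<Sum>j\<in>N. if l j = 1 then seqstep_weight c \<alpha> l ?r j else 0)
      = (\<Sum>j\<in>N. if l j = 1 then reset_weight m c \<alpha> f l w x b u e j else 0)"
    by (intro sum.cong refl) (auto simp: reset_weight_def fun_upd_idem)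
  finally show ?thesis .
qed

text \<open>A decoy that is not a training decoy has pseudo label \<open>1\<close> both before and
  after its flip. All the flipped runs therefore share the ranking of the actual run, and the bound
  for a single ranking applies.\<close>

lemma sum_reset_weight_le_1:
  assumes "distinct e" "finite N" "set e \<subseteq> {1..m}"
  shows "(\<Sum>j\<in>N. if l j = -1 \<and> \<not> b j then reset_weight m c \<alpha> f l w x b u e j else 0) \<le> 1"
proof -
  let ?r = "reset_ranking m f l w x b u e"
  have "reset_ranking m f (l(j := 1)) w x b u e = ?r" if "l j = -1" "\<not> b j" for j
  proof -
    have "pseudo_label (l(j := 1)) b = pseudo_label l b"
      using that by (auto simp: pseudo_label_def fun_eq_iff)
    then show ?thesis by (simp add: reset_ranking_def)
  qed
  then have "(\<Sum>j\<in>N. if l j = -1 \<and> \<not> b j then reset_weight m c \<alpha> f l w x b u e j else 0)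
      \<le> (\<Sum>j\<in>N. if l j = -1 then seqstep_weight c \<alpha> (l(j := 1)) ?r j else 0)"
    by (intro sum_mono) (auto simp: reset_weight_def seqstep_weight_nonneg)
  also have "\<dots> \<le> 1"
    using assms by (intro sum_seqstep_weight_flip_le_1 distinct_reset_ranking)
  finally show ?thesis .
qed

section \<open>Measurability and conditional odds\<close>

text \<open>A random subset of a finite set has finitely many values, and each of them is singled
  out by finitely many of the measurable conditions. This turns labels, coins and comparisons of
  scores into discrete variables.\<close>

lemma measurable_finite_Collect:
  assumes "finite I" "\<And>i. i \<in> I \<Longrightarrow> {z \<in> space Z. P i z} \<in> sets Z"
  shows "(\<lambda>z. {i \<in> I. P i z}) \<in> measurable Z (count_space (Pow I))"
  unfolding measurable_count_space_eq2[OF finite_Pow_iff[THEN iffD2, OF assms(1)]]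
proof safe
  fix A assume A: "A \<subseteq> I"
  have "(\<lambda>z. {i \<in> I. P i z}) -` {A} \<inter> space Z = {z \<in> space Z. \<forall>i\<in>I. (P i z \<longleftrightarrow> i \<in> A)}"
    using A by auto
  also have "\<dots> \<in> sets Z"
  proof (intro sets.sets_Collect_finite_All assms(1))
    fix i assume "i \<in> I"
    then show "{z \<in> space Z. P i z \<longleftrightarrow> i \<in> A} \<in> sets Z"
      using assms(2) by (cases "i \<in> A") (auto intro: sets.sets_Collect_neg)
  qed
  finally show "(\<lambda>z. {i \<in> I. P i z}) -` {A} \<inter> space Z \<in> sets Z" .
qed

text \<open>The weight is a function of four variables with finitely many values: the set of target
  wins, the set of successful coins, the enumeration and the order relation of the new scores. The
  space \<open>Z\<close> is arbitrary because the lemma serves both for the product space and for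
  the conditioning sigma-algebra with the internal randomness held fixed.\<close>

lemma measurable_reset_weight:
  fixes X :: "'x measure" and U :: "'u measure" and Z :: "'z measure"
    and f :: "'u \<Rightarrow> (nat \<Rightarrow> real \<times> 'x \<times> int) \<Rightarrow> nat \<Rightarrow> real"
  assumes f: "(\<lambda>(u, d). f u d) \<in> measurable
      (U \<Otimes>\<^sub>M (\<Pi>\<^sub>M i\<in>{1..m}. borel \<Otimes>\<^sub>M X \<Otimes>\<^sub>M count_space UNIV)) (\<Pi>\<^sub>M i\<in>{1..m}. borel)"
    and L: "\<And>i. i \<in> {1..m} \<Longrightarrow> L i \<in> measurable Z (count_space UNIV)"
    and L01: "\<And>i z. i \<in> {1..m} \<Longrightarrow> z \<in> space Z \<Longrightarrow> L i z \<in> {-1, 1}"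
    and W: "\<And>i. i \<in> {1..m} \<Longrightarrow> W i \<in> borel_measurable Z"
    and x: "\<And>i. i \<in> {1..m} \<Longrightarrow> x i \<in> measurable Z X"
    and b: "\<And>i. i \<in> {1..m} \<Longrightarrow> b i \<in> measurable Z (count_space UNIV)"
    and u: "u \<in> measurable Z U"
    and e: "e \<in> measurable Z (count_space (permutations_of_set {1..m}))"
  shows "(\<lambda>z. reset_weight m c \<alpha> f (\<lambda>i. L i z) (\<lambda>i. W i z) (\<lambda>i. x i z) (\<lambda>i. b i z) (u z) (e z) j)
           \<in> borel_measurable Z"
proof -
  define I where "I = {1..m}"
  have finI: "finite I" by (simp add: I_def)
  define p where "p z = pseudo_label ((\<lambda>i. L i z)(j := 1)) (\<lambda>i. b i z)" for z
  define w where "w z = f (u z) (\<lambda>i\<in>I. (W i z, x i z, p z i))" for z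
  define S where "S z = {i \<in> I. L i z = 1}" for z
  define B where "B z = {i \<in> I. b i z}" for z
  define R where "R z = {q \<in> I \<times> I. w z (fst q) \<le> w z (snd q)}" for z
  \<comment> \<open>Since labels lie in \<open>{-1, 1}\<close>, the set of target wins determines
    them. The flip of \<open>j\<close> is built in.\<close>
  define l where "l S i = (if i = j \<or> i \<in> S then 1 else -1 :: int)" for S i
  define G where "G S B e R = seqstep_weight c \<alpha> (l S)
    (seqstep_ranking (\<lambda>i. real (card {k. (k, i) \<in> R}))
      (filter (\<lambda>i. pseudo_label (l S) (\<lambda>i. i \<in> B) i = 1) e)) j" for S B e and R :: "(nat \<times> nat) set"

  have [measurable]: "(\<lambda>z. p z i) \<in> measurable Z (count_space UNIV)" if "i \<in> I" for i
  proof -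
    have [measurable]: "L i \<in> measurable Z (count_space UNIV)" "b i \<in> measurable Z (count_space UNIV)"
      using that L b by (auto simp: I_def)
    show ?thesis
      unfolding p_def pseudo_label_def fun_upd_def by measurable
  qed
  have wM: "(\<lambda>z. w z i) \<in> borel_measurable Z" if "i \<in> I" for i
  proof -
    have "(\<lambda>z. (u z, \<lambda>i\<in>I. (W i z, x i z, p z i))) \<in> measurable Z
        (U \<Otimes>\<^sub>M (\<Pi>\<^sub>M i\<in>I. borel \<Otimes>\<^sub>M X \<Otimes>\<^sub>M count_space UNIV))"
      using u W[folded I_def] x[folded I_def] by (intro measurable_Pair measurable_restrict) auto
    from measurable_compose[OF this f[folded I_def]]
    have "w \<in> measurable Z (\<Pi>\<^sub>M i\<in>I. borel)"
      by (simp add: w_def[abs_def])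
    from measurable_compose[OF this measurable_component_singleton[OF that]]
    show ?thesis .
  qed
  have SM: "S \<in> measurable Z (count_space (Pow I))"
    unfolding S_def
  proof (intro measurable_finite_Collect finI)
    fix i assume "i \<in> I"
    then have [measurable]: "L i \<in> measurable Z (count_space UNIV)" using L by (simp add: I_def)
    show "{z \<in> space Z. L i z = 1} \<in> sets Z" by measurable
  qed
  have BM: "B \<in> measurable Z (count_space (Pow I))"
    unfolding B_def
  proof (intro measurable_finite_Collect finI)
    fix i assume "i \<in> I"
    then have [measurable]: "b i \<in> measurable Z (count_space UNIV)" using b by (simp add: I_def)
    show "{z \<in> space Z. b i z} \<in> sets Z" by measurable
  qed
  have RM: "R \<in> measurable Z (count_space (Pow (I \<times> I)))"
    unfolding R_def
  proof (intro measurable_finite_Collect finite_cartesian_product finI)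
    fix q assume "q \<in> I \<times> I"
    then have [measurable]: "(\<lambda>z. w z (fst q)) \<in> borel_measurable Z"
        "(\<lambda>z. w z (snd q)) \<in> borel_measurable Z"
      using wM by auto
    show "{z \<in> space Z. w z (fst q) \<le> w z (snd q)} \<in> sets Z" by measurable
  qed
  \<comment> \<open>The discrete arguments are frozen one after the other.\<close>
  have "(\<lambda>z. G (S z) (B z) (e z) (R z)) \<in> borel_measurable Z"
  proof (rule measurable_compose_countable'[OF _ SM])
    fix S' show "(\<lambda>z. G S' (B z) (e z) (R z)) \<in> borel_measurable Z"
    proof (rule measurable_compose_countable'[OF _ BM])
      fix B' show "(\<lambda>z. G S' B' (e z) (R z)) \<in> borel_measurable Z"
      proof (rule measurable_compose_countable'[OF _ e])
        fix e' show "(\<lambda>z. G S' B' e' (R z)) \<in> borel_measurable Z"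
          by (rule measurable_compose_countable'[OF _ RM]) (auto simp: finI countable_finite)
      qed (simp add: countable_finite)
    qed (simp add: finI countable_finite)
  qed (simp add: finI countable_finite)
  moreover have "reset_weight m c \<alpha> f (\<lambda>i. L i z) (\<lambda>i. W i z) (\<lambda>i. x i z) (\<lambda>i. b i z) (u z) (e z) j
      = G (S z) (B z) (e z) (R z)" if z: "z \<in> space Z" for z
  proof -
    have setE: "set (e z) = I"
      using measurable_space[OF e z] by (auto simp: I_def permutations_of_set_def)
    have lS: "((\<lambda>i. L i z)(j := 1)) i = l (S z) i" if "i \<in> I" for i
      using L01[of i z] that z by (auto simp: l_def S_def I_def)
    have "pseudo_label (l (S z)) (\<lambda>i. i \<in> B z) i = p z i" if "i \<in> I" for i
      unfolding p_def pseudo_label_def lS[OF that] using that by (simp add: B_def)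
    then have filter: "filter (\<lambda>i. p z i = 1) (e z)
        = filter (\<lambda>i. pseudo_label (l (S z)) (\<lambda>i. i \<in> B z) i = 1) (e z)" (is "_ = ?e")
      by (intro filter_cong) (auto simp: setE)
    have "reset_ranking m f ((\<lambda>i. L i z)(j := 1)) (\<lambda>i. W i z) (\<lambda>i. x i z) (\<lambda>i. b i z) (u z) (e z)
        = seqstep_ranking (w z) ?e"
      unfolding reset_ranking_def filter[symmetric] by (simp add: w_def p_def I_def)
    also have "\<dots> = seqstep_ranking (\<lambda>i. real (card {k. (k, i) \<in> R z})) ?e" (is "_ = ?r")
      by (rule seqstep_ranking_ranks[OF finI]) (auto simp: R_def setE)
    finally have "reset_weight m c \<alpha> f (\<lambda>i. L i z) (\<lambda>i. W i z) (\<lambda>i. x i z) (\<lambda>i. b i z) (u z) (e z) j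
        = seqstep_weight c \<alpha> ((\<lambda>i. L i z)(j := 1)) ?r j"
      unfolding reset_weight_def by simp
    \<comment> \<open>Outside \<open>I\<close> the two labellings may differ, but the ranking
      consists of indices in \<open>I\<close>.\<close>
    also have "\<dots> = seqstep_weight c \<alpha> (l (S z)) ?r j"
      by (intro seqstep_weight_cong lS) (simp add: seqstep_ranking_def setE)
    finally show ?thesis by (simp add: G_def)
  qed
  ultimately show ?thesis
    by (subst measurable_cong)
qed

section \<open>Conditional probabilities and the conditional odds of one label\<close>

lemma AE_sigma_cond_prob_nonneg:
  assumes "prob_space M" "subalgebra M F" "A \<in> sets M"
  shows "AE \<omega> in M. 0 \<le> sigma_cond_prob M F A \<omega>"
proof -
  interpret prob_space M by fact
  interpret finite_measure_subalgebra M F by unfold_locales fact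
  show ?thesis
    unfolding sigma_cond_prob_def using assms(3) by (intro real_cond_exp_pos) auto
qed

lemma AE_sigma_cond_prob_compl:
  assumes "prob_space M" "subalgebra M F" "A \<in> sets M"
  shows "AE \<omega> in M. sigma_cond_prob M F (space M - A) \<omega> = 1 - sigma_cond_prob M F A \<omega>"
proof -
  interpret prob_space M by fact
  interpret finite_measure_subalgebra M F by unfold_locales fact
  note [measurable] = assms(3)
  have "AE \<omega> in M. real_cond_exp M F (indicator (space M - A)) \<omega>
      = real_cond_exp M F (\<lambda>\<omega>. 1 - indicator A \<omega>) \<omega>"
    by (intro real_cond_exp_cong AE_I2) (auto simp: indicator_def)
  moreover have "AE \<omega> in M. real_cond_exp M F (\<lambda>\<omega>. 1 - indicator A \<omega>) \<omega>
      = real_cond_exp M F (\<lambda>\<omega>. 1) \<omega> - real_cond_exp M F (indicator A) \<omega>"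
    by (intro real_cond_exp_diff) (auto simp: less_top[symmetric])
  moreover have "AE \<omega> in M. real_cond_exp M F (\<lambda>\<omega>. 1) \<omega> = 1"
    by (intro real_cond_exp_F_meas) auto
  ultimately show ?thesis
    unfolding sigma_cond_prob_def by eventually_elim simp
qed

text \<open>Conditioning in addition on the other labels leaves the odds of \<open>L j\<close> unchanged; they are at
  most \<open>c0 / (1 - c0)\<close>.\<close>

lemma cond_indep_label_odds:
  fixes L :: "nat \<Rightarrow> 'a \<Rightarrow> int"
  assumes M: "prob_space M" and F: "subalgebra M F" and N: "finite N" "j \<in> N" and "c0 < 1"
    and L: "\<And>i. i \<in> N \<Longrightarrow> L i \<in> measurable M (count_space UNIV)"
    and L01: "\<And>i \<omega>. i \<in> N \<Longrightarrow> \<omega> \<in> space M \<Longrightarrow> L i \<omega> \<in> {-1, 1}"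
    and indep: "cond_indep_vars M F (\<lambda>_. count_space UNIV) L N"
    and c0: "AE \<omega> in M. sigma_cond_prob M F {\<omega>' \<in> space M. L j \<omega>' = 1} \<omega> \<le> c0"
    and h: "\<And>l. h l \<in> borel_measurable F"
    and h0: "\<And>l \<omega>. 0 \<le> h l \<omega>" and h1: "\<And>l \<omega>. h l \<omega> \<le> (1::real)"
    and h_cong: "\<And>l l' \<omega>. (\<And>i. i \<in> N \<Longrightarrow> i \<noteq> j \<Longrightarrow> l i = l' i) \<Longrightarrow> h l \<omega> = h l' \<omega>"
  shows "(\<integral>\<omega>. (if L j \<omega> = 1 then h (\<lambda>i. L i \<omega>) \<omega> else 0) \<partial>M)
    \<le> c0 / (1 - c0) * (\<integral>\<omega>. (if L j \<omega> = -1 then h (\<lambda>i. L i \<omega>) \<omega> else 0) \<partial>M)"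
proof -
  interpret prob_space M by fact
  interpret finite_measure_subalgebra M F by unfold_locales fact
  define l where "l S i = (if i \<in> S then 1 else -1 :: int)" for S and i :: nat
  define A where "A v S = (\<Inter>i\<in>N. L i -` {if i = j then v else l S i} \<inter> space M)" for v S
  define p where "p v = sigma_cond_prob M F (L j -` {v} \<inter> space M)" for v
  define q where "q S \<omega> = (\<Prod>i\<in>N - {j}. sigma_cond_prob M F (L i -` {l S i} \<inter> space M) \<omega>)" for S \<omega>
  have LM: "L i -` V \<inter> space M \<in> sets M" if "i \<in> N" for i V
    using L[OF that] by (rule measurable_sets) simp
  have AM [measurable]: "A v S \<in> sets M" for v S
    unfolding A_def using N LM by (intro sets.finite_INT) auto
  have hM [measurable]: "h l \<in> borel_measurable M" for l
    by (rule measurable_from_subalg[OF F h])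
  have int: "integrable M (\<lambda>\<omega>. h l \<omega> * indicator (A v S) \<omega>)" for l v S
    by (rule integrable_const_bound[where B = 1]) (auto simp: indicator_def h0 h1)
  \<comment> \<open>With random labels inserted, \<open>h\<close> need not be
    \<open>F\<close>-measurable. Summing over the possible sets \<open>S\<close> of target wins
    among the other nulls replaces it by the \<open>F\<close>-measurable functions
    \<open>h (l S)\<close>.\<close>
  have split: "(\<integral>\<omega>. (if L j \<omega> = v then h (\<lambda>i. L i \<omega>) \<omega> else 0) \<partial>M)
      = (\<Sum>S\<in>Pow (N - {j}). \<integral>\<omega>. h (l S) \<omega> * indicator (A v S) \<omega> \<partial>M)" for v
  proof -
    have "(if L j \<omega> = v then h (\<lambda>i. L i \<omega>) \<omega> else 0)
        = (\<Sum>S\<in>Pow (N - {j}). h (l S) \<omega> * indicator (A v S) \<omega>)" if \<omega>: "\<omega> \<in> space M" for \<omega>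
    proof -
      define S0 where "S0 = {i \<in> N - {j}. L i \<omega> = 1}"
      have in_A: "\<omega> \<in> A v S \<longleftrightarrow> L j \<omega> = v \<and> S = S0" if "S \<in> Pow (N - {j})" for S
      proof -
        have "L i \<omega> = l S i \<longleftrightarrow> (i \<in> S \<longleftrightarrow> i \<in> S0)" if "i \<in> N" "i \<noteq> j" for i
          using that L01[of i \<omega>] \<omega> by (auto simp: l_def S0_def)
        moreover have "\<omega> \<in> A v S \<longleftrightarrow> L j \<omega> = v \<and> (\<forall>i\<in>N - {j}. L i \<omega> = l S i)"
          using N \<omega> by (auto simp: A_def)
        moreover have "S = S0 \<longleftrightarrow> (\<forall>i\<in>N - {j}. i \<in> S \<longleftrightarrow> i \<in> S0)"
          using that by (auto simp: S0_def)
        ultimately show ?thesis by auto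
      qed
      have "(\<Sum>S\<in>Pow (N - {j}). h (l S) \<omega> * indicator (A v S) \<omega>)
          = (\<Sum>S\<in>Pow (N - {j}). if S = S0 then (if L j \<omega> = v then h (l S0) \<omega> else 0) else 0)"
        by (intro sum.cong refl) (simp add: indicator_def in_A)
      also have "\<dots> = (if L j \<omega> = v then h (l S0) \<omega> else 0)"
        using N(1) by (subst sum.delta) (auto simp: S0_def)
      \<comment> \<open>The vector \<open>l S0\<close> is \<open>-1\<close> at \<open>j\<close> and
        outside \<open>N\<close>, where it may differ from the labels. These are the positions that
        \<open>h_cong\<close> leaves free.\<close>
      also have "h (l S0) \<omega> = h (\<lambda>i. L i \<omega>) \<omega>"
        using L01 \<omega> by (intro h_cong) (fastforce simp: l_def S0_def)
      finally show ?thesis by simp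
    qed
    then have "(\<integral>\<omega>. (if L j \<omega> = v then h (\<lambda>i. L i \<omega>) \<omega> else 0) \<partial>M)
        = (\<integral>\<omega>. (\<Sum>S\<in>Pow (N - {j}). h (l S) \<omega> * indicator (A v S) \<omega>) \<partial>M)"
      by (intro Bochner_Integration.integral_cong refl)
    then show ?thesis
      using int by (simp add: Bochner_Integration.integral_sum)
  qed
  \<comment> \<open>The factor of \<open>j\<close> is split off the product over \<open>N\<close>.
    What remains, \<open>q S\<close>, is the same for \<open>v = 1\<close> and
    \<open>v = -1\<close>.\<close>
  have factor: "AE \<omega> in M. real_cond_exp M F (indicator (A v S)) \<omega> = p v \<omega> * q S \<omega>" for v S
  proof -
    let ?V = "\<lambda>i. {if i = j then v else l S i}"
    have "AE \<omega> in M. sigma_cond_prob M F (\<Inter>i\<in>N. L i -` ?V i \<inter> space M) \<omega>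
        = (\<Prod>i\<in>N. sigma_cond_prob M F (L i -` ?V i \<inter> space M) \<omega>)"
      using indep N unfolding cond_indep_vars_def by (elim conjE allE[of _ N]) auto
    moreover have "(\<Prod>i\<in>N. sigma_cond_prob M F (L i -` ?V i \<inter> space M) \<omega>) = p v \<omega> * q S \<omega>" for \<omega>
      unfolding p_def q_def prod.remove[OF N] by simp
    ultimately show ?thesis
      by (simp add: A_def sigma_cond_prob_def)
  qed
  have p_neg: "AE \<omega> in M. p (-1) \<omega> = 1 - p 1 \<omega>"
  proof -
    have "L j -` {-1} \<inter> space M = space M - (L j -` {1} \<inter> space M)"
      using L01[OF N(2)] by fastforce
    then show ?thesis
      unfolding p_def using AE_sigma_cond_prob_compl[OF M F LM[OF N(2), of "{1}"]] by simp
  qed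
  have p_le: "AE \<omega> in M. p 1 \<omega> \<le> c0"
  proof -
    have "{\<omega>' \<in> space M. L j \<omega>' = 1} = L j -` {1} \<inter> space M" by auto
    with c0 show ?thesis by (simp add: p_def)
  qed
  have q0: "AE \<omega> in M. 0 \<le> q S \<omega>" for S
  proof -
    have "AE \<omega> in M. \<forall>i\<in>N - {j}. 0 \<le> sigma_cond_prob M F (L i -` {l S i} \<inter> space M) \<omega>"
      using N LM by (intro AE_finite_allI AE_sigma_cond_prob_nonneg M F) auto
    then show ?thesis
      unfolding q_def by eventually_elim (auto intro: prod_nonneg)
  qed
  have le: "(\<integral>\<omega>. h (l S) \<omega> * indicator (A 1 S) \<omega> \<partial>M)
      \<le> c0 / (1 - c0) * (\<integral>\<omega>. h (l S) \<omega> * indicator (A (-1) S) \<omega> \<partial>M)" for S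
  proof -
    have "AE \<omega> in M. h (l S) \<omega> * real_cond_exp M F (indicator (A 1 S)) \<omega>
        \<le> c0 / (1 - c0) * (h (l S) \<omega> * real_cond_exp M F (indicator (A (-1) S)) \<omega>)"
      using factor[of 1 S] factor[of "-1" S] p_neg p_le q0[of S]
    proof eventually_elim
      case (elim \<omega>)
      \<comment> \<open>This is \<open>p 1 \<omega> \<le> c0\<close> in terms of odds. It survives
        multiplication by the nonnegative factor common to both events.\<close>
      have "p 1 \<omega> \<le> c0 / (1 - c0) * (1 - p 1 \<omega>)"
        using elim(4) \<open>c0 < 1\<close> by (simp add: field_simps)
      then have "(h (l S) \<omega> * q S \<omega>) * p 1 \<omega> \<le> (h (l S) \<omega> * q S \<omega>) * (c0 / (1 - c0) * (1 - p 1 \<omega>))"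
        using elim(5) h0 by (intro mult_left_mono) auto
      then show ?case
        unfolding elim(1-3) by (simp add: mult_ac)
    qed
    then have "(\<integral>\<omega>. h (l S) \<omega> * real_cond_exp M F (indicator (A 1 S)) \<omega> \<partial>M)
        \<le> (\<integral>\<omega>. c0 / (1 - c0) * (h (l S) \<omega> * real_cond_exp M F (indicator (A (-1) S)) \<omega>) \<partial>M)"
      by (intro integral_mono_AE integrable_mult_right real_cond_exp_intg(1) int h) auto
    then show ?thesis
      by (simp add: real_cond_exp_intg(2)[OF int h])
  qed
  show ?thesis
    unfolding split sum_distrib_left by (intro sum_mono le)
qed

text \<open>By Tonelli the coordinate \<open>j\<close> can be integrated first. As \<open>h\<close>
  ignores it, only the probability \<open>1 - s\<close> of a failed coin comes out.\<close>

lemma nn_integral_bernoulli_coin: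
  assumes "finite I" "j \<in> I" "0 \<le> s" "s \<le> 1"
    and h: "h \<in> borel_measurable (\<Pi>\<^sub>M i\<in>I. measure_pmf (bernoulli_pmf s))"
    and h_upd: "\<And>b y. h (b(j := y)) = h b"
  shows "(\<integral>\<^sup>+ b. (if b j then 0 else h b) \<partial>(\<Pi>\<^sub>M i\<in>I. measure_pmf (bernoulli_pmf s)))
       = ennreal (1 - s) * (\<integral>\<^sup>+ b. h b \<partial>(\<Pi>\<^sub>M i\<in>I. measure_pmf (bernoulli_pmf s)))"
proof -
  let ?B = "\<lambda>_::'a. measure_pmf (bernoulli_pmf s)"
  interpret product_sigma_finite ?B
    by (simp add: product_sigma_finite_def measure_pmf.sigma_finite_measure_axioms)
  have I: "I = insert j (I - {j})" using assms(2) by auto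
  have [measurable]: "(\<lambda>b. b j) \<in> measurable (PiM I ?B) (count_space UNIV)"
    using measurable_component_singleton[OF assms(2), of ?B] by (simp cong: measurable_cong_sets)
  have h' [measurable]: "(\<lambda>b. if b j then 0 else h b) \<in> borel_measurable (PiM I ?B)"
    using h by measurable
  have "(\<integral>\<^sup>+ b. (if b j then 0 else h b) \<partial>PiM I ?B)
      = (\<integral>\<^sup>+ b. (\<integral>\<^sup>+ y. (if y then 0 else h b) \<partial>?B j) \<partial>PiM (I - {j}) ?B)"
    using product_nn_integral_insert[of "I - {j}" j "\<lambda>b. if b j then 0 else h b"] h' assms(1) I
    by (simp add: h_upd insert_absorb cong: if_cong)
  also have "\<dots> = (\<integral>\<^sup>+ b. ennreal (1 - s) * h b \<partial>PiM (I - {j}) ?B)"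
    using assms(3,4) by (simp add: mult.commute)
  \<comment> \<open>The coordinate \<open>j\<close> is put back: the inner integral is that of a
    constant over a probability measure.\<close>
  also have "\<dots> = (\<integral>\<^sup>+ b. (\<integral>\<^sup>+ y. ennreal (1 - s) * h (b(j := y)) \<partial>?B j) \<partial>PiM (I - {j}) ?B)"
    by (simp add: h_upd measure_pmf.emeasure_space_1)
  also have "\<dots> = (\<integral>\<^sup>+ b. ennreal (1 - s) * h b \<partial>PiM I ?B)"
    using product_nn_integral_insert[of "I - {j}" j "\<lambda>b. ennreal (1 - s) * h b"] h assms(1) I
    by (simp add: insert_absorb)
  finally show ?thesis
    using h by (simp add: nn_integral_cmult)
qed

section \<open>FDR control\<close>

theorem theorem1:
  fixes M :: "'a measure" and X :: "'x measure" and U :: "'u measure"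
    and m :: nat and N :: "nat set" and \<alpha> s c0 :: real
    and L :: "nat \<Rightarrow> 'a \<Rightarrow> int" and W :: "nat \<Rightarrow> 'a \<Rightarrow> real" and x :: "nat \<Rightarrow> 'a \<Rightarrow> 'x"
    and f :: "'u \<Rightarrow> (nat \<Rightarrow> real \<times> 'x \<times> int) \<Rightarrow> nat \<Rightarrow> real"
  assumes "prob_space M" and "prob_space U"
    and "0 < \<alpha>" "\<alpha> < 1" and "0 \<le> s" "s < 1" and "0 < c0" "c0 < 1"
    and "N \<subseteq> {1..m}"
    and "\<And>i. i \<in> {1..m} \<Longrightarrow> L i \<in> measurable M (count_space UNIV)"
    and "\<And>i. i \<in> {1..m} \<Longrightarrow> W i \<in> borel_measurable M"
    and "\<And>i. i \<in> {1..m} \<Longrightarrow> x i \<in> measurable M X"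
    and "\<And>i \<omega>. i \<in> {1..m} \<Longrightarrow> \<omega> \<in> space M \<Longrightarrow> L i \<omega> \<in> {-1, 1}"
    and "cond_indep_vars M (conditioning_algebra M X m N L W x) (\<lambda>_. count_space UNIV) L N"
    and "\<And>i. i \<in> N \<Longrightarrow> AE \<omega> in M.
           sigma_cond_prob M (conditioning_algebra M X m N L W x)
             {\<omega>' \<in> space M. L i \<omega>' = 1} \<omega> \<le> c0"
    and "(\<lambda>(u, d). f u d) \<in> measurable
           (U \<Otimes>\<^sub>M (\<Pi>\<^sub>M i\<in>{1..m}. borel \<Otimes>\<^sub>M X \<Otimes>\<^sub>M count_space UNIV)) (\<Pi>\<^sub>M i\<in>{1..m}. borel)"
  shows "reset_fdr M U m N \<alpha> s c0 f L W x \<le> \<alpha>"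
proof -
  note L = assms(10) and W = assms(11) and x = assms(12) and L01 = assms(13) and f = assms(16)

  \<comment> \<open>Constants and probability spaces\<close>
  define c where "c = c0 / (1 - s * (1 - c0))"
  define E where "E = uniform_count_measure (permutations_of_set {1..m})"
  define B where "B = (\<Pi>\<^sub>M i\<in>{1..m}. measure_pmf (bernoulli_pmf s))"
  define F where "F = conditioning_algebra M X m N L W x"
  define g where "g = (\<lambda>j (\<omega>, b, u, e).
    reset_weight m c \<alpha> f (\<lambda>i. L i \<omega>) (\<lambda>i. W i \<omega>) (\<lambda>i. x i \<omega>) b u e j)"
  let ?R = "reset_randomness m s U"
  let ?Q = "M \<Otimes>\<^sub>M ?R"
  have R_eq: "?R = B \<Otimes>\<^sub>M U \<Otimes>\<^sub>M E"
    by (simp add: reset_randomness_def B_def E_def)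

  interpret M: prob_space M by fact
  interpret U: prob_space U by fact
  interpret B: prob_space B
    unfolding B_def by (intro prob_space_PiM prob_space_measure_pmf)
  interpret E: prob_space E
    unfolding E_def by (intro prob_space_uniform_count_measure) auto
  interpret UE: pair_prob_space U E ..
  interpret BUE: pair_prob_space B "U \<Otimes>\<^sub>M E" ..
  have R: "prob_space ?R"
    unfolding R_eq by (rule BUE.prob_space_axioms)
  interpret R: prob_space ?R by fact
  interpret Q: pair_prob_space M ?R ..

  have sp: "1 - s * (1 - c0) > 0"
    using assms(5-8) mult_strict_mono[of s 1 "1 - c0" 1] by (simp add: mult_less_cancel_left)
  have "c > 0" using sp assms(7) by (simp add: c_def)
  have "c0 < 1 - s * (1 - c0)"
  proof -
    have "s * (1 - c0) < 1 * (1 - c0)" using assms(6,8) by (intro mult_strict_right_mono) auto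
    then show ?thesis by simp
  qed
  then have "c < 1" using sp by (simp add: c_def)
  \<comment> \<open>Trading a target win for a decoy that is not a training decoy costs
    \<open>c0 / (1 - c0)\<close> for the label and \<open>1 / (1 - s)\<close> for the coin. The
    parameter \<open>c\<close> is chosen so that its odds equal this product.\<close>
  have odds: "(1 - c) / c * (c0 / (1 - c0) / (1 - s)) = 1"
  proof -
    have "(1 - c) / c = 1 / c - 1"
      using \<open>0 < c\<close> by (simp add: diff_divide_distrib)
    also have "\<dots> = (1 - s * (1 - c0)) / c0 - 1"
      by (simp add: c_def)
    also have "\<dots> = (1 - s) * (1 - c0) / c0"
      using assms(7) by (simp add: field_simps)
    finally have "(1 - c) / c = (1 - s) * (1 - c0) / c0" .
    then show ?thesis using assms(6-8) by simp
  qed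
  have finN: "finite N" using assms(9) finite_subset by blast

  have E_space: "e \<in> space E \<Longrightarrow> distinct e \<and> set e = {1..m}" for e
    by (simp add: E_def space_uniform_count_measure permutations_of_set_def)
  have E_measurable: "(\<lambda>e. e) \<in> measurable E (count_space (permutations_of_set {1..m}))"
    by (simp add: E_def measurable_def space_uniform_count_measure sets_uniform_count_measure)
  have B_measurable: "(\<lambda>b. b i) \<in> measurable B (count_space UNIV)" if "i \<in> {1..m}" for i
    using measurable_component_singleton[OF that, of "\<lambda>_. measure_pmf (bernoulli_pmf s)"]
    unfolding B_def by (simp cong: measurable_cong_sets)

  have g0: "0 \<le> g j z" and g1: "g j z \<le> 1" for j z
    by (simp_all add: g_def split_beta reset_weight_nonneg reset_weight_le_1)
  have gM [measurable]: "g j \<in> borel_measurable ?Q" for j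
    unfolding g_def split_beta R_eq
  proof (rule measurable_reset_weight[OF f])
    show "L i (fst z) \<in> {-1, 1}" if "i \<in> {1..m}" "z \<in> space (M \<Otimes>\<^sub>M B \<Otimes>\<^sub>M U \<Otimes>\<^sub>M E)" for i z
      using that by (intro L01) (auto simp: space_pair_measure)
    show "(\<lambda>z. snd (snd (snd z))) \<in> measurable (M \<Otimes>\<^sub>M B \<Otimes>\<^sub>M U \<Otimes>\<^sub>M E)
        (count_space (permutations_of_set {1..m}))"
      by (intro measurable_compose[OF measurable_snd] E_measurable)
    show "(\<lambda>z. fst (snd z) i) \<in> measurable (M \<Otimes>\<^sub>M B \<Otimes>\<^sub>M U \<Otimes>\<^sub>M E) (count_space UNIV)"
      if "i \<in> {1..m}" for i
      by (intro measurable_compose[OF measurable_snd] measurable_compose[OF measurable_fst] B_measurable that)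
  qed (simp_all only: measurable_compose[OF measurable_fst L]
      measurable_compose[OF measurable_fst W] measurable_compose[OF measurable_fst x], measurable)
  have LM [measurable]: "L j \<in> measurable M (count_space UNIV)" if "j \<in> N" for j
    using that assms(9) L by auto
  have bM [measurable]: "(\<lambda>z. fst (snd z) j) \<in> measurable ?Q (count_space UNIV)" if "j \<in> N" for j
    unfolding R_eq using that assms(9)
    by (intro measurable_compose[OF measurable_snd measurable_compose[OF measurable_fst B_measurable]]) auto

  \<comment> \<open>The passage from \<open>G1\<close> to \<open>G2\<close> uses the conditional law
    of the label with the internal randomness fixed, the passage from \<open>G2\<close> to
    \<open>G3\<close> the law of the coin with the data fixed.\<close>
  define G1 where "G1 j z = (if L j (fst z) = 1 then g j z else 0)" for j z
  define G2 where "G2 j z = (if L j (fst z) = -1 then g j z else 0)" for j z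
  define G3 where "G3 j z = (if L j (fst z) = -1 \<and> \<not> fst (snd z) j then g j z else 0)" for j z
  have GM [measurable]: "G1 j \<in> borel_measurable ?Q" "G2 j \<in> borel_measurable ?Q"
      "G3 j \<in> borel_measurable ?Q" if "j \<in> N" for j
  proof -
    note [measurable] = LM[OF that] bM[OF that]
    show "G1 j \<in> borel_measurable ?Q" "G2 j \<in> borel_measurable ?Q" "G3 j \<in> borel_measurable ?Q"
      unfolding G1_def[abs_def] G2_def[abs_def] G3_def[abs_def] by measurable
  qed
  have G0: "0 \<le> G1 j z" "0 \<le> G2 j z" "0 \<le> G3 j z"
    and G_le: "G1 j z \<le> 1" "G2 j z \<le> 1" "G3 j z \<le> 1" for j z
    by (auto simp: G1_def G2_def G3_def g0 g1)
  have G_int: "integrable ?Q (G1 j)" "integrable ?Q (G2 j)" "integrable ?Q (G3 j)" if "j \<in> N" for j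
    using GM[OF that] by (auto intro!: Q.integrable_const_bound[where B = 1] simp: G0 G_le)

  \<comment> \<open>Exchanging labels and coins\<close>
  have subalg: "subalgebra M F" and WF: "\<And>i. i \<in> {1..m} \<Longrightarrow> W i \<in> borel_measurable F"
    and xF: "\<And>i. i \<in> {1..m} \<Longrightarrow> x i \<in> measurable F X"
    and LF: "\<And>i. i \<in> {1..m} - N \<Longrightarrow> L i \<in> measurable F (count_space UNIV)"
  proof -
    let ?T = "\<lambda>\<omega>. (\<lambda>i\<in>{1..m}. W i \<omega>, \<lambda>i\<in>{1..m}. x i \<omega>, \<lambda>i\<in>{1..m} - N. L i \<omega>)"
    let ?P = "(\<Pi>\<^sub>M i\<in>{1..m}. borel :: real measure) \<Otimes>\<^sub>M (\<Pi>\<^sub>M i\<in>{1..m}. X) \<Otimes>\<^sub>M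
      (\<Pi>\<^sub>M i\<in>{1..m} - N. count_space (UNIV :: int set))"
    have F_eq: "F = vimage_algebra (space M) ?T ?P"
      by (simp add: F_def conditioning_algebra_def)
    have T: "?T \<in> measurable M ?P"
      using L W x by (intro measurable_Pair measurable_restrict) auto
    show "subalgebra M F"
      unfolding subalgebra_def F_eq using sets_image_in_sets[OF refl T] by simp
    have TF: "?T \<in> measurable F ?P"
      unfolding F_eq using measurable_space[OF T] by (intro measurable_vimage_algebra1) auto
    show "W i \<in> borel_measurable F" if "i \<in> {1..m}" for i
      using measurable_compose[OF TF measurable_compose[OF measurable_fst
          measurable_component_singleton[OF that]]] that by simp
    show "x i \<in> measurable F X" if "i \<in> {1..m}" for i
      using measurable_compose[OF TF measurable_compose[OF measurable_snd
          measurable_compose[OF measurable_fst measurable_component_singleton[OF that]]]] that by simp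
    show "L i \<in> measurable F (count_space UNIV)" if "i \<in> {1..m} - N" for i
      using measurable_compose[OF TF measurable_compose[OF measurable_snd
          measurable_compose[OF measurable_snd measurable_component_singleton[OF that]]]] that by simp
  qed
  have space_F: "space F = space M" using subalg by (simp add: subalgebra_def)

  \<comment> \<open>For a fixed \<open>\<rho>\<close>, the weight of \<open>j\<close> depends on
    \<open>\<omega>\<close> only through \<open>F\<close> and the labels of the other nulls, so the
    bound on the conditional odds applies.\<close>
  have swap: "(\<integral>\<^sup>+ \<omega>. G1 j (\<omega>, \<rho>) \<partial>M) \<le> ennreal (c0 / (1 - c0)) * (\<integral>\<^sup>+ \<omega>. G2 j (\<omega>, \<rho>) \<partial>M)"
    if j: "j \<in> N" and \<rho>: "\<rho> \<in> space ?R" for j \<rho>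
  proof -
    obtain b u e where \<rho>_eq: "\<rho> = (b, u, e)" by (cases \<rho>)
    have u: "u \<in> space U" and e: "e \<in> space E"
      using \<rho> by (auto simp: R_eq \<rho>_eq space_pair_measure)
    have sete: "set e = {1..m}" using E_space[OF e] by simp
    \<comment> \<open>\<open>l\<close> is clamped to \<open>{-1, 1}\<close> so that \<open>h l\<close> is measurable for every \<open>l\<close>.\<close>
    define h where "h l \<omega> = reset_weight m c \<alpha> f (\<lambda>i. if i \<in> N then (if l i = 1 then 1 else -1) else L i \<omega>)
      (\<lambda>i. W i \<omega>) (\<lambda>i. x i \<omega>) b u e j" for l :: "nat \<Rightarrow> int" and \<omega>
    have h_eq: "h (\<lambda>i. L i \<omega>) \<omega> = g j (\<omega>, \<rho>)" if "\<omega> \<in> space M" for \<omega>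
      unfolding h_def g_def \<rho>_eq using L01[OF _ that] sete assms(9)
      by (simp, intro reset_weight_cong) fastforce+
    have "(\<integral>\<omega>. (if L j \<omega> = 1 then h (\<lambda>i. L i \<omega>) \<omega> else 0) \<partial>M)
      \<le> c0 / (1 - c0) * (\<integral>\<omega>. (if L j \<omega> = -1 then h (\<lambda>i. L i \<omega>) \<omega> else 0) \<partial>M)"
    proof (rule cond_indep_label_odds[OF assms(1) subalg finN j assms(8)])
      show "L i \<in> measurable M (count_space UNIV)" if "i \<in> N" for i
        using that by (rule LM)
      show "L i \<omega> \<in> {-1, 1}" if "i \<in> N" "\<omega> \<in> space M" for i \<omega>
        using that L01 assms(9) by blast
      show "cond_indep_vars M F (\<lambda>_. count_space UNIV) L N"
        unfolding F_def by fact
      show "AE \<omega> in M. sigma_cond_prob M F {\<omega>' \<in> space M. L j \<omega>' = 1} \<omega> \<le> c0"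
        unfolding F_def by (rule assms(15)[OF j])
      show "h l \<in> borel_measurable F" for l
        unfolding h_def[abs_def]
      proof (rule measurable_reset_weight[OF f])
        show "(\<lambda>\<omega>. if i \<in> N then (if l i = 1 then 1 else -1) else L i \<omega>) \<in> measurable F (count_space UNIV)"
          if "i \<in> {1..m}" for i
          using LF[of i] that by (cases "i \<in> N") auto
        show "(if i \<in> N then (if l i = 1 then 1 else -1) else L i \<omega>) \<in> {-1, 1}"
          if "i \<in> {1..m}" "\<omega> \<in> space F" for i \<omega>
          using L01[of i \<omega>] that by (auto simp: space_F)
        show "(\<lambda>\<omega>. e) \<in> measurable F (count_space (permutations_of_set {1..m}))"
          using e by (intro measurable_const) (simp add: E_def space_uniform_count_measure)
      qed (use u WF xF in auto)
      show "0 \<le> h l \<omega>" "h l \<omega> \<le> 1" for l \<omega>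
        by (simp_all add: h_def reset_weight_nonneg reset_weight_le_1)
      show "h l \<omega> = h l' \<omega>" if "\<And>i. i \<in> N \<Longrightarrow> i \<noteq> j \<Longrightarrow> l i = l' i" for l l' \<omega>
        unfolding h_def using that sete by (intro reset_weight_cong) auto
    qed
    moreover have "(\<integral>\<omega>. (if L j \<omega> = 1 then h (\<lambda>i. L i \<omega>) \<omega> else 0) \<partial>M) = (\<integral>\<omega>. G1 j (\<omega>, \<rho>) \<partial>M)"
      "(\<integral>\<omega>. (if L j \<omega> = -1 then h (\<lambda>i. L i \<omega>) \<omega> else 0) \<partial>M) = (\<integral>\<omega>. G2 j (\<omega>, \<rho>) \<partial>M)"
      by (auto intro!: Bochner_Integration.integral_cong simp: G1_def G2_def h_eq)
    ultimately have le: "(\<integral>\<omega>. G1 j (\<omega>, \<rho>) \<partial>M) \<le> c0 / (1 - c0) * (\<integral>\<omega>. G2 j (\<omega>, \<rho>) \<partial>M)"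
      by simp
    have int: "integrable M (\<lambda>\<omega>. G1 j (\<omega>, \<rho>))" "integrable M (\<lambda>\<omega>. G2 j (\<omega>, \<rho>))"
      using GM[OF j] \<rho> by (auto intro!: M.integrable_const_bound[where B = 1] simp: G0 G_le)
    have "(\<integral>\<^sup>+ \<omega>. G1 j (\<omega>, \<rho>) \<partial>M) = ennreal (\<integral>\<omega>. G1 j (\<omega>, \<rho>) \<partial>M)"
      using int by (intro nn_integral_eq_integral) (auto simp: G0)
    also have "\<dots> \<le> ennreal (c0 / (1 - c0) * (\<integral>\<omega>. G2 j (\<omega>, \<rho>) \<partial>M))"
      using le by (rule ennreal_leI)
    also have "\<dots> = ennreal (c0 / (1 - c0)) * ennreal (\<integral>\<omega>. G2 j (\<omega>, \<rho>) \<partial>M)"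
      using assms(7,8) by (intro ennreal_mult) (auto intro!: Bochner_Integration.integral_nonneg simp: G0)
    also have "ennreal (\<integral>\<omega>. G2 j (\<omega>, \<rho>) \<partial>M) = (\<integral>\<^sup>+ \<omega>. G2 j (\<omega>, \<rho>) \<partial>M)"
      using int by (intro nn_integral_eq_integral[symmetric]) (auto simp: G0)
    finally show ?thesis .
  qed

  have coin: "(\<integral>\<^sup>+ \<rho>. G3 j (\<omega>, \<rho>) \<partial>?R) = ennreal (1 - s) * (\<integral>\<^sup>+ \<rho>. G2 j (\<omega>, \<rho>) \<partial>?R)"
    if j: "j \<in> N" and \<omega>: "\<omega> \<in> space M" for j \<omega>
  proof -
    have GR: "(\<lambda>\<rho>. G2 j (\<omega>, \<rho>)) \<in> borel_measurable (B \<Otimes>\<^sub>M U \<Otimes>\<^sub>M E)"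
      "(\<lambda>\<rho>. G3 j (\<omega>, \<rho>)) \<in> borel_measurable (B \<Otimes>\<^sub>M U \<Otimes>\<^sub>M E)"
      using measurable_compose[OF measurable_Pair1'[OF \<omega>] GM(2)[OF j]]
        measurable_compose[OF measurable_Pair1'[OF \<omega>] GM(3)[OF j]] by (simp_all add: R_eq)
    have "(\<integral>\<^sup>+ b. G3 j (\<omega>, b, v) \<partial>B) = ennreal (1 - s) * (\<integral>\<^sup>+ b. G2 j (\<omega>, b, v) \<partial>B)"
      if v: "v \<in> space (U \<Otimes>\<^sub>M E)" for v
    proof -
      obtain u e where v_eq: "v = (u, e)" by (cases v)
      have sete: "set e = {1..m}" using v E_space by (auto simp: v_eq space_pair_measure)
      \<comment> \<open>The coin of \<open>j\<close> enters neither the weight of \<open>j\<close>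
        nor the event that \<open>j\<close> is a decoy win.\<close>
      have "G2 j (\<omega>, b(j := y), v) = G2 j (\<omega>, b, v)" for b y
        unfolding G2_def g_def v_eq using sete
        by (auto intro!: reset_weight_cong)
      moreover have "(\<lambda>b. ennreal (G2 j (\<omega>, b, v))) \<in> borel_measurable B"
        using measurable_compose[OF measurable_Pair2'[OF v] GR(1)] by simp
      ultimately have "(\<integral>\<^sup>+ b. (if b j then 0 else ennreal (G2 j (\<omega>, b, v))) \<partial>B)
          = ennreal (1 - s) * (\<integral>\<^sup>+ b. G2 j (\<omega>, b, v) \<partial>B)"
        unfolding B_def using assms(5,6,9) j by (intro nn_integral_bernoulli_coin) auto
      moreover have "ennreal (G3 j (\<omega>, b, v)) = (if b j then 0 else ennreal (G2 j (\<omega>, b, v)))" for b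
        by (simp add: G2_def G3_def)
      ultimately show ?thesis by simp
    qed
    note coin_b = this
    note [measurable] = GR
    have "(\<integral>\<^sup>+ \<rho>. G3 j (\<omega>, \<rho>) \<partial>?R) = (\<integral>\<^sup>+ v. (\<integral>\<^sup>+ b. G3 j (\<omega>, b, v) \<partial>B) \<partial>(U \<Otimes>\<^sub>M E))"
      unfolding R_eq by (subst BUE.nn_integral_snd[symmetric]) auto
    also have "\<dots> = (\<integral>\<^sup>+ v. ennreal (1 - s) * (\<integral>\<^sup>+ b. G2 j (\<omega>, b, v) \<partial>B) \<partial>(U \<Otimes>\<^sub>M E))"
      by (intro nn_integral_cong coin_b)
    also have "\<dots> = ennreal (1 - s) * (\<integral>\<^sup>+ v. (\<integral>\<^sup>+ b. G2 j (\<omega>, b, v) \<partial>B) \<partial>(U \<Otimes>\<^sub>M E))"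
      by (intro nn_integral_cmult) measurable
    also have "(\<integral>\<^sup>+ v. (\<integral>\<^sup>+ b. G2 j (\<omega>, b, v) \<partial>B) \<partial>(U \<Otimes>\<^sub>M E)) = (\<integral>\<^sup>+ \<rho>. G2 j (\<omega>, \<rho>) \<partial>?R)"
      unfolding R_eq by (subst BUE.nn_integral_snd[symmetric]) auto
    finally show ?thesis .
  qed

  have le: "(\<integral>z. G1 j z \<partial>?Q) \<le> c0 / (1 - c0) / (1 - s) * (\<integral>z. G3 j z \<partial>?Q)" if j: "j \<in> N" for j
  proof -
    note [measurable] = GM[OF j]
    \<comment> \<open>Tonelli is applied to nonnegative integrals, and the results are transferred
      back to real integrals.\<close>
    have to_real: "(\<integral>\<^sup>+ z. G z \<partial>?Q) = ennreal (\<integral>z. G z \<partial>?Q)" if "integrable ?Q G" "\<And>z. 0 \<le> G z" for G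
      using that by (intro nn_integral_eq_integral) auto
    have "(\<integral>\<^sup>+ z. G1 j z \<partial>?Q) = (\<integral>\<^sup>+ \<rho>. (\<integral>\<^sup>+ \<omega>. G1 j (\<omega>, \<rho>) \<partial>M) \<partial>?R)"
      by (subst Q.nn_integral_snd[symmetric]) auto
    also have "\<dots> \<le> (\<integral>\<^sup>+ \<rho>. ennreal (c0 / (1 - c0)) * (\<integral>\<^sup>+ \<omega>. G2 j (\<omega>, \<rho>) \<partial>M) \<partial>?R)"
      using swap[OF j] by (intro nn_integral_mono)
    also have "\<dots> = ennreal (c0 / (1 - c0)) * (\<integral>\<^sup>+ \<rho>. (\<integral>\<^sup>+ \<omega>. G2 j (\<omega>, \<rho>) \<partial>M) \<partial>?R)"
      by (intro nn_integral_cmult) measurable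
    also have "(\<integral>\<^sup>+ \<rho>. (\<integral>\<^sup>+ \<omega>. G2 j (\<omega>, \<rho>) \<partial>M) \<partial>?R) = (\<integral>\<^sup>+ z. G2 j z \<partial>?Q)"
      by (subst Q.nn_integral_snd[symmetric]) auto
    finally have 1: "(\<integral>z. G1 j z \<partial>?Q) \<le> c0 / (1 - c0) * (\<integral>z. G2 j z \<partial>?Q)"
      using G_int[OF j] assms(7,8)
      by (simp add: to_real G0 ennreal_mult'[symmetric] Bochner_Integration.integral_nonneg)
    \<comment> \<open>Here the order of integration is reversed, with the internal randomness
      innermost, since \<open>coin\<close> holds for each fixed \<open>\<omega>\<close>.\<close>
    have "(\<integral>\<^sup>+ z. G3 j z \<partial>?Q) = (\<integral>\<^sup>+ \<omega>. (\<integral>\<^sup>+ \<rho>. G3 j (\<omega>, \<rho>) \<partial>?R) \<partial>M)"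
      by (subst R.nn_integral_fst[symmetric]) auto
    also have "\<dots> = (\<integral>\<^sup>+ \<omega>. ennreal (1 - s) * (\<integral>\<^sup>+ \<rho>. G2 j (\<omega>, \<rho>) \<partial>?R) \<partial>M)"
      using coin[OF j] by (intro nn_integral_cong)
    also have "\<dots> = ennreal (1 - s) * (\<integral>\<^sup>+ \<omega>. (\<integral>\<^sup>+ \<rho>. G2 j (\<omega>, \<rho>) \<partial>?R) \<partial>M)"
      by (intro nn_integral_cmult) measurable
    also have "(\<integral>\<^sup>+ \<omega>. (\<integral>\<^sup>+ \<rho>. G2 j (\<omega>, \<rho>) \<partial>?R) \<partial>M) = (\<integral>\<^sup>+ z. G2 j z \<partial>?Q)"
      by (subst R.nn_integral_fst[symmetric]) auto
    finally have "(\<integral>z. G3 j z \<partial>?Q) = (1 - s) * (\<integral>z. G2 j z \<partial>?Q)"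
      using G_int[OF j] assms(6)
      by (simp add: to_real G0 ennreal_mult'[symmetric] Bochner_Integration.integral_nonneg)
    with 1 show ?thesis using assms(6) by simp
  qed

  \<comment> \<open>Combining the pointwise bounds with the exchange inequality\<close>
  have "reset_fdr M U m N \<alpha> s c0 f L W x \<le> (\<integral>z. \<alpha> * ((1 - c) / c) * (\<Sum>j\<in>N. G1 j z) \<partial>?Q)"
    unfolding reset_fdr_def
    \<comment> \<open>This rule needs no integrability of the FDP: otherwise its integral is \<open>0\<close>.\<close>
  proof (rule integral_mono')
    show "integrable ?Q (\<lambda>z. \<alpha> * ((1 - c) / c) * (\<Sum>j\<in>N. G1 j z))"
      using G_int by (intro integrable_mult_right Bochner_Integration.integrable_sum)
    fix z assume "z \<in> space ?Q"
    then obtain \<omega> b u e where z: "z = (\<omega>, b, u, e)" "e \<in> space E"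
      by (auto simp: R_eq space_pair_measure)
    have "fdp N (reset_discoveries m \<alpha> s c0 f (\<lambda>i. L i \<omega>) (\<lambda>i. W i \<omega>) (\<lambda>i. x i \<omega>) b u e)
        \<le> \<alpha> * ((1 - c) / c) * (\<Sum>j\<in>N. G1 j z)"
      using fdp_reset_le[OF _ finN \<open>0 < c\<close> \<open>c < 1\<close> c_def, of e m \<alpha> f "\<lambda>i. L i \<omega>"
          "\<lambda>i. W i \<omega>" "\<lambda>i. x i \<omega>" b u] E_space[OF z(2)]
      by (simp add: z(1) G1_def g_def cong: if_cong)
    then show "(case z of (\<omega>, b, u, enum) \<Rightarrow>
        fdp N (reset_discoveries m \<alpha> s c0 f (\<lambda>i. L i \<omega>) (\<lambda>i. W i \<omega>) (\<lambda>i. x i \<omega>) b u enum))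
        \<le> \<alpha> * ((1 - c) / c) * (\<Sum>j\<in>N. G1 j z)"
      by (simp add: z(1))
    show "0 \<le> \<alpha> * ((1 - c) / c) * (\<Sum>j\<in>N. G1 j z)"
      using assms(3) \<open>0 < c\<close> \<open>c < 1\<close> by (intro mult_nonneg_nonneg sum_nonneg G0) auto
  qed
  also have "\<dots> = \<alpha> * ((1 - c) / c) * (\<Sum>j\<in>N. \<integral>z. G1 j z \<partial>?Q)"
    using G_int by simp
  also have "\<dots> \<le> \<alpha> * ((1 - c) / c) * (\<Sum>j\<in>N. c0 / (1 - c0) / (1 - s) * (\<integral>z. G3 j z \<partial>?Q))"
    using assms(3) \<open>0 < c\<close> \<open>c < 1\<close> by (intro mult_left_mono sum_mono le) auto
  also have "\<dots> = \<alpha> * ((1 - c) / c * (c0 / (1 - c0) / (1 - s))) * (\<Sum>j\<in>N. \<integral>z. G3 j z \<partial>?Q)"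
    by (simp only: sum_distrib_left[symmetric] mult.assoc)
  \<comment> \<open>The factor from the cutoff test and the cost of the exchange cancel.\<close>
  also have "\<dots> = \<alpha> * (\<integral>z. (\<Sum>j\<in>N. G3 j z) \<partial>?Q)"
    unfolding odds using G_int by simp
  also have "\<dots> \<le> \<alpha> * (\<integral>z. 1 \<partial>?Q)"
  proof (intro mult_left_mono Bochner_Integration.integral_mono)
    fix z assume "z \<in> space ?Q"
    then obtain \<omega> b u e where z: "z = (\<omega>, b, u, e)" "e \<in> space E"
      by (auto simp: R_eq space_pair_measure)
    show "(\<Sum>j\<in>N. G3 j z) \<le> 1"
      using sum_reset_weight_le_1[OF _ finN, of e m "\<lambda>i. L i \<omega>" b c \<alpha> f "\<lambda>i. W i \<omega>" "\<lambda>i. x i \<omega>" u]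
        E_space[OF z(2)]
      by (simp add: z(1) G3_def g_def cong: if_cong)
  qed (use G_int assms(3) in auto)
  also have "\<dots> = \<alpha>"
    using Q.prob_space by simp
  finally show ?thesis .
qed

end
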